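(* For every $q\in(1,\infty)$, with Hölder conjugate $p$ (i.e. $\frac1p+\frac1q=1$), we have $$N_q^{\mathrm{int},+}(\varepsilon,d)\ge C_p^d\,(1-2\varepsilon)\qquad\text{for all }d\in\mathbb{N}\text{ and }\varepsilon\in[0,\tfrac12),$$ where $C_p>1$ is a number depending only on $p$, and it is the same number for which the extreme $L_p$ discrepancy satisfies $N_p^{\mathrm{disc},+}(\varepsilon,d)\ge C_p^d(1-2\varepsilon)$ for all $d\in\mathbb{N}$ and $\varepsilon\in[0,\frac12)$. In other words, integration in $F_{d,q}$ with non-negative linear rules suffers from the curse of dimensionality.
   Context: $\mathbb{N}=\{1,2,\ldots\}$. Let $\mathbb{D}_d:=\{(\boldsymbol{a},\boldsymbol{b})\in[0,1]^d\times[0,1]^d:\ a_j\le b_j \text{ for all } j\}$, equipped with $2d$-dimensional Lebesgue measure; $[\boldsymbol a,\boldsymbol b)=\prod_{j=1}^d[a_j,b_j)$, $[\boldsymbol a,\boldsymbol b]=\prod_{j=1}^d[a_j,b_j]$, and $\mathbf{1}_C$ is the indicator function of $C$. Function space. For $c\in L_q(\mathbb{D}_d)$ and $\boldsymbol x\in[0,1]^d$ put $(T_dc)(\boldsymbol x):=\int_{\mathbb{D}_d}c(\boldsymbol a,\boldsymbol b)\,\mathbf{1}_{[\boldsymbol a,\boldsymbol b]}(\boldsymbol x)\,\mathrm{d}(\boldsymbol a,\boldsymbol b)$. Let $F_{d,q}:=\{T_dc:\ c\in L_q(\mathbb{D}_d)\}$ with norm $\|f\|_{F_{d,q},\mathrm{box}}:=\inf\{\|c\|_{L_q(\mathbb{D}_d)}:\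 c\in L_q(\mathbb{D}_d),\ f=T_dc\}$. Integration. Let $I(f)=\int_{[0,1]^d}f(\boldsymbol x)\,\mathrm{d}\boldsymbol x$. For points $\mathcal{P}=\{\boldsymbol x_1,\ldots,\boldsymbol x_N\}\subset[0,1)^d$ and real weights $\mathcal{A}=\{c_1,\ldots,c_N\}$ let $Q_{\mathcal{P},\mathcal{A}}(f)=\sum_{k=1}^Nc_kf(\boldsymbol x_k)$ and $e(Q_{\mathcal{P},\mathcal{A}};F_{d,q})=\sup_{\|f\|_{F_{d,q},\mathrm{box}}\le1}|I(f)-Q_{\mathcal{P},\mathcal{A}}(f)|$. Let $e_q^+(N,d)$ be the minimum (read as an infimum) of $e(Q_{\mathcal{P},\mathcal{A}^+};F_{d,q})$ over all $N$-element point sets $\mathcal{P}\subset[0,1)^d$ and all non-negative weights $\mathcal{A}^+$, and let $e_q(0,d)=e(0;F_{d,q})=\sup_{\|f\|_{F_{d,q},\mathrm{box}}\le1}|I(f)|$ be the initial error. Put $$N_q^{\mathrm{int},+}(\varepsilon,d):=\min\{N\in\mathbb{N}:\ e_q^+(N,d)\le\varepsilon\,e_q(0,d)\},\qquad \min\emptyset=\infty.$$ Discrepancy. Let $$L_{p,N}^{\mathrm{ext}}(\mathcal{P},\mathcal{A})=\left(\int_{\mathbb{D}_d}\Big|\sum_{k=1}^N c_k\,\mathbf{1}_{[\boldsymbol a,\boldsymbol b)}(\boldsymbol x_k)-\prod_{j=1}^d(b_j-a_j)\Big|^p\,\mathrm{d}(\boldsymbol a,\boldsymbol b)\right)^{1/p},\quad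 L_{p,0}^{\mathrm{ext}}=((p+1)(p+2))^{-d/p},$$ let $\mathrm{disc}_p^{\mathrm{ext},+}(N,d)$ be the minimum (read as an infimum) of $L_{p,N}^{\mathrm{ext}}(\mathcal{P},\mathcal{A}^+)$ over the same $\mathcal{P}$ and non-negative $\mathcal{A}^+$, and let $N_p^{\mathrm{disc},+}(\varepsilon,d):=\min\{N\in\mathbb{N}:\ \mathrm{disc}_p^{\mathrm{ext},+}(N,d)\le\varepsilon\,L_{p,0}^{\mathrm{ext}}\}$ (with $\min\emptyset=\infty$). The curse of dimensionality means at least exponential growth in $d$ for fixed $\varepsilon$: here, in the sense of a lower bound of the displayed form with $C_p>1$. *)

theory Defs
  imports "HOL-Analysis.Analysis"
begin

text \<open>
  The dimension is quantified inside the final statement, so points of real \<open>d\<close>-space are functions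
  on \<open>{..<d}\<close>, extended by \<open>undefined\<close> outside \<open>{..<d}\<close> as in the library's product measures.
\<close>

type_synonym point = "nat \<Rightarrow> real"

definition leb :: "nat \<Rightarrow> point measure" where
  "leb d = Pi\<^sub>M {..<d} (\<lambda>_. lborel)"

definition unit_cube :: "nat \<Rightarrow> point set" where
  "unit_cube d = (\<Pi>\<^sub>E j\<in>{..<d}. {0..1})"

definition unit_cube_ho :: "nat \<Rightarrow> point set" where
  "unit_cube_ho d = (\<Pi>\<^sub>E j\<in>{..<d}. {0..<1})"

definition box_cl :: "nat \<Rightarrow> point \<Rightarrow> point \<Rightarrow> point set" where
  "box_cl d a b = (\<Pi>\<^sub>E j\<in>{..<d}. {a j..b j})"

definition box_ho :: "nat \<Rightarrow> point \<Rightarrow> point \<Rightarrow> point set" where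
  "box_ho d a b = (\<Pi>\<^sub>E j\<in>{..<d}. {a j..<b j})"

definition boxes :: "nat \<Rightarrow> (point \<times> point) set" where
  "boxes d = {(a, b). a \<in> unit_cube d \<and> b \<in> unit_cube d \<and> (\<forall>j<d. a j \<le> b j)}"

definition leb_boxes :: "nat \<Rightarrow> (point \<times> point) measure" where
  "leb_boxes d = restrict_space (leb d \<Otimes>\<^sub>M leb d) (boxes d)"

text \<open>
  Elements of \<open>L_q\<close> are given by Borel representatives. Everything below depends on them only up
  to null sets.
\<close>

definition Lq :: "nat \<Rightarrow> real \<Rightarrow> (point \<times> point \<Rightarrow> real) set" where
  "Lq d q = {c \<in> borel_measurable (leb_boxes d). integrable (leb_boxes d) (\<lambda>z. \<bar>c z\<bar> powr q)}"

definition Lq_norm :: "nat \<Rightarrow> real \<Rightarrow> (point \<times> point \<Rightarrow> real) \<Rightarrow> real" where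
  "Lq_norm d q c = (\<integral>z. \<bar>c z\<bar> powr q \<partial>leb_boxes d) powr (1 / q)"

text \<open>Functions on the closed unit cube are made extensional, so that equality of functions is
  equality on the cube.\<close>

definition T_op :: "nat \<Rightarrow> (point \<times> point \<Rightarrow> real) \<Rightarrow> (point \<Rightarrow> real)" where
  "T_op d c = (\<lambda>x\<in>unit_cube d. \<integral>(a, b). c (a, b) * indicator (box_cl d a b) x \<partial>leb_boxes d)"

definition F_space :: "nat \<Rightarrow> real \<Rightarrow> (point \<Rightarrow> real) set" where
  "F_space d q = T_op d ` Lq d q"

definition box_norm :: "nat \<Rightarrow> real \<Rightarrow> (point \<Rightarrow> real) \<Rightarrow> real" where
  "box_norm d q f = Inf {Lq_norm d q c | c. c \<in> Lq d q \<and> f = T_op d c}"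

definition Int_cube :: "nat \<Rightarrow> (point \<Rightarrow> real) \<Rightarrow> real" where
  "Int_cube d f = (LINT x:unit_cube d|leb d. f x)"

definition lin_rule :: "point set \<Rightarrow> (point \<Rightarrow> real) \<Rightarrow> (point \<Rightarrow> real) \<Rightarrow> real" where
  "lin_rule P w f = (\<Sum>x\<in>P. w x * f x)"

definition nonneg_rules :: "nat \<Rightarrow> nat \<Rightarrow> (point set \<times> (point \<Rightarrow> real)) set" where
  "nonneg_rules N d =
     {(P, w). P \<subseteq> unit_cube_ho d \<and> finite P \<and> card P = N \<and> (\<forall>x\<in>P. 0 \<le> w x)}"

definition wc_error :: "nat \<Rightarrow> real \<Rightarrow> ((point \<Rightarrow> real) \<Rightarrow> real) \<Rightarrow> ereal" where
  "wc_error d q Q =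
     (SUP f\<in>{f \<in> F_space d q. box_norm d q f \<le> 1}. ereal \<bar>Int_cube d f - Q f\<bar>)"

definition initial_error :: "real \<Rightarrow> nat \<Rightarrow> ereal" where
  "initial_error q d = wc_error d q (\<lambda>_. 0)"

definition min_error_nonneg :: "real \<Rightarrow> nat \<Rightarrow> nat \<Rightarrow> ereal" where
  "min_error_nonneg q N d = (INF (P, w)\<in>nonneg_rules N d. wc_error d q (lin_rule P w))"

definition N_int :: "real \<Rightarrow> real \<Rightarrow> nat \<Rightarrow> enat" where
  "N_int q \<epsilon> d =
     Inf {enat N | N. 1 \<le> N \<and> min_error_nonneg q N d \<le> ereal \<epsilon> * initial_error q d}"

definition L_ext :: "nat \<Rightarrow> real \<Rightarrow> point set \<Rightarrow> (point \<Rightarrow> real) \<Rightarrow> real" where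
  "L_ext d p P w =
     (\<integral>(a, b). \<bar>(\<Sum>x\<in>P. w x * indicator (box_ho d a b) x) - (\<Prod>j<d. b j - a j)\<bar> powr p
        \<partial>leb_boxes d) powr (1 / p)"

definition L_ext_initial :: "real \<Rightarrow> nat \<Rightarrow> real" where
  "L_ext_initial p d = ((p + 1) * (p + 2)) powr (- real d / p)"

definition min_disc_nonneg :: "real \<Rightarrow> nat \<Rightarrow> nat \<Rightarrow> ereal" where
  "min_disc_nonneg p N d = (INF (P, w)\<in>nonneg_rules N d. ereal (L_ext d p P w))"

definition N_disc :: "real \<Rightarrow> real \<Rightarrow> nat \<Rightarrow> enat" where
  "N_disc p \<epsilon> d =
     Inf {enat N | N. 1 \<le> N \<and> min_disc_nonneg p N d \<le> ereal (\<epsilon> * L_ext_initial p d)}"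

end

theory Submission
  imports Defs
begin

text \<open>
  The constant is \<open>C p = 1 / \<rho>\<close> with \<open>\<rho> = 1 - (1/3) powr (p + 2)\<close>, and the reason for the curse is that
  \<open>N\<close> points miss most boxes, even when a box is weighted with the \<open>p\<close>-th power of its volume. In
  dimension one, give the interval \<open>[a,b]\<close> the weight \<open>(b - a) powr p\<close>. The intervals that contain a
  given point carry at most the share \<open>\<rho>\<close> of the total weight, because they avoid one of the outer
  thirds of \<open>[0,1]\<close> (\<open>nn_integral_length_powr_containing\<close>). In dimension \<open>d\<close> weights and containment
  factorise, so a point is contained in boxes of share at most \<open>\<rho> ^ d\<close>, and the boxes without any of the
  \<open>N\<close> points carry at least the share \<open>1 - N * \<rho> ^ d\<close> (\<open>integral_missing_boxes_ge\<close>).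

  On a box without points the local discrepancy has the absolute value of the volume. So the extreme
  discrepancy, relative to its initial value, is at least \<open>(1 - N * \<rho> ^ d) powr (1 / p)\<close>
  whenever that base is positive
  (\<open>missing_norm_le_L_ext\<close>).

  For integration, the integral of \<open>T_op d c\<close> is the pairing of \<open>c\<close> with the volume function
  (\<open>Int_cube_T_op\<close>), so by Hoelder's inequality the initial error is at most the initial discrepancy
  (\<open>initial_error_le\<close>). Restricting the extremal \<open>c\<close> to the boxes without points gives a function that
  vanishes at the nodes and whose integral has the same lower bound as the discrepancy
  (\<open>missing_norm_le_wc_error\<close>).

  In both problems, an error of at most \<open>\<epsilon>\<close> times the initial one forces
  \<open>1 - N * \<rho> ^ d \<le> \<epsilon> powr p \<le> \<epsilon>\<close>, whence \<open>N \<ge> C p ^ d * (1 - \<epsilon>)\<close>, and this is at least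
  \<open>C p ^ d * (1 - 2 * \<epsilon>)\<close>.
\<close>

section \<open>Powers of the length of a random subinterval\<close>

definition unit_triangle :: "(real \<times> real) set" where
  "unit_triangle = {(a, b). 0 \<le> a \<and> a \<le> b \<and> b \<le> 1}"

lemma nn_integral_length_powr_on_subinterval:
  fixes p u v :: real
  assumes "0 < p" "u \<le> v"
  shows "(\<integral>\<^sup>+a. \<integral>\<^sup>+b. ennreal ((b - a) powr p) * indicator {(a, b). u \<le> a \<and> a \<le> b \<and> b \<le> v} (a, b)
      \<partial>lborel \<partial>lborel) = ennreal ((v - u) powr (p + 2) / ((p + 1) * (p + 2)))"
proof -
  have inner: "(\<integral>\<^sup>+b. ennreal ((b - a) powr p) * indicator {a..v} b \<partial>lborel)
      = ennreal ((v - a) powr (p + 1) / (p + 1))" if "a \<le> v" for a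
  proof (rule nn_integral_has_integral_lebesgue')
    have "((\<lambda>x. x powr p) has_integral ((v - a) powr (p + 1) / (p + 1))) {0..v - a}"
      using assms that by (intro has_integral_powr_from_0) auto
    from has_integral_affinity[OF this[unfolded cbox_interval[symmetric]], of 1 "-a"]
    show "((\<lambda>b. (b - a) powr p) has_integral ((v - a) powr (p + 1) / (p + 1))) {a..v}"
      by simp
  qed auto
  have "((\<lambda>x. x powr (p + 1)) has_integral ((v - u) powr (p + 2) / (p + 2))) {0..v - u}"
    using has_integral_powr_from_0[of "p + 1" "v - u"] assms by (simp add: add.commute)
  from has_integral_affinity[OF this[unfolded cbox_interval[symmetric]], of "-1" v]
  have "((\<lambda>a. (v - a) powr (p + 1)) has_integral ((v - u) powr (p + 2) / (p + 2))) {u..v}"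
    using assms by simp
  then have "((\<lambda>a. (v - a) powr (p + 1) / (p + 1)) has_integral
      ((v - u) powr (p + 2) / (p + 2)) / (p + 1)) {u..v}"
    by (rule has_integral_divide)
  then have outer: "(\<integral>\<^sup>+a. ennreal ((v - a) powr (p + 1) / (p + 1)) * indicator {u..v} a \<partial>lborel)
      = ennreal ((v - u) powr (p + 2) / (p + 2) / (p + 1))"
    using assms by (intro nn_integral_has_integral_lebesgue') auto
  have "(\<integral>\<^sup>+b. ennreal ((b - a) powr p) * indicator {(a, b). u \<le> a \<and> a \<le> b \<and> b \<le> v} (a, b) \<partial>lborel)
      = ennreal ((v - a) powr (p + 1) / (p + 1)) * indicator {u..v} a" for a
  proof (cases "a \<in> {u..v}")
    case True
    then have "(\<lambda>b. ennreal ((b - a) powr p) * indicator {(a, b). u \<le> a \<and> a \<le> b \<and> b \<le> v} (a, b))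
      = (\<lambda>b. ennreal ((b - a) powr p) * indicator {a..v} b)"
      by (auto simp: fun_eq_iff indicator_def)
    then show ?thesis using inner[of a] True by simp
  next
    case False
    then have "(\<lambda>b. ennreal ((b - a) powr p) * indicator {(a, b). u \<le> a \<and> a \<le> b \<and> b \<le> v} (a, b))
      = (\<lambda>b. 0)"
      by (auto simp: fun_eq_iff indicator_def)
    then show ?thesis using False by simp
  qed
  then show ?thesis using outer by (simp add: mult.commute)
qed

lemma nn_integral_length_powr_triangle:
  fixes p :: real
  assumes "0 < p"
  shows "(\<integral>\<^sup>+a. \<integral>\<^sup>+b. ennreal ((b - a) powr p) * indicator unit_triangle (a, b) \<partial>lborel \<partial>lborel)
    = ennreal (1 / ((p + 1) * (p + 2)))"
  using nn_integral_length_powr_on_subinterval[OF assms, of 0 1] by (simp add: unit_triangle_def)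

lemma unit_triangle_borel [measurable]: "unit_triangle \<in> sets (borel \<Otimes>\<^sub>M borel)"
proof -
  have "unit_triangle = {z \<in> space (borel \<Otimes>\<^sub>M borel). 0 \<le> fst z \<and> fst z \<le> snd z \<and> snd z \<le> 1}"
    by (auto simp: unit_triangle_def space_pair_measure)
  also have "\<dots> \<in> sets (borel \<Otimes>\<^sub>M borel)"
    by measurable
  finally show ?thesis .
qed

text \<open>
  An interval containing \<open>x\<close> cannot lie inside an outer third of \<open>[0,1]\<close> that misses \<open>x\<close>, and at
  least one of the two outer thirds does miss \<open>x\<close>. The intervals inside a third carry the fraction
  \<open>(1/3) powr (p + 2)\<close> of the whole integral, by scaling. The gap between the two thirds keeps the
  argument valid for closed intervals and pointwise, with no boundary case at \<open>x = 1/2\<close>.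
\<close>

lemma nn_integral_length_powr_containing:
  fixes p x :: real
  assumes "0 < p"
  shows "(\<integral>\<^sup>+a. \<integral>\<^sup>+b. ennreal ((b - a) powr p) * indicator {a..b} x * indicator unit_triangle (a, b) \<partial>lborel \<partial>lborel)
    \<le> ennreal ((1 - (1/3) powr (p + 2)) / ((p + 1) * (p + 2)))"
proof -
  \<comment> \<open>\<open>[u, u + 1/3]\<close> is an outer third that misses \<open>x\<close>.\<close>
  define u :: real where "u = (if x \<ge> 1/2 then 0 else 2/3)"
  define T where "T = {(a, b). u \<le> a \<and> a \<le> b \<and> b \<le> u + 1/3}"
  define f g where "f = (\<lambda>a b. ennreal ((b - a) powr p) * indicator {a..b} x * indicator unit_triangle (a, b))"
    and "g = (\<lambda>a b. ennreal ((b - a) powr p) * indicator T (a, b))"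
  have "T = {z \<in> space (borel \<Otimes>\<^sub>M borel). u \<le> fst z \<and> fst z \<le> snd z \<and> snd z \<le> u + 1/3}"
    by (auto simp: T_def space_pair_measure)
  also have "\<dots> \<in> sets (borel \<Otimes>\<^sub>M borel)"
    by measurable
  finally have T[measurable]: "T \<in> sets (borel \<Otimes>\<^sub>M borel)" .
  have f[measurable]: "case_prod f \<in> borel_measurable (lborel \<Otimes>\<^sub>M lborel)"
    unfolding f_def split_beta' indicator_def atLeastAtMost_iff by measurable
  have g[measurable]: "case_prod g \<in> borel_measurable (lborel \<Otimes>\<^sub>M lborel)"
    unfolding g_def split_beta' by measurable
  \<comment> \<open>\<open>f\<close> and \<open>g\<close> have disjoint supports, so together they stay below the full integrand.\<close>
  have "(\<integral>\<^sup>+a. \<integral>\<^sup>+b. f a b \<partial>lborel \<partial>lborel) + (\<integral>\<^sup>+a. \<integral>\<^sup>+b. g a b \<partial>lborel \<partial>lborel)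
      = (\<integral>\<^sup>+a. \<integral>\<^sup>+b. f a b + g a b \<partial>lborel \<partial>lborel)"
    by (subst nn_integral_add[symmetric], measurable)+
  also have "\<dots> \<le> (\<integral>\<^sup>+a. \<integral>\<^sup>+b. ennreal ((b - a) powr p) * indicator unit_triangle (a, b) \<partial>lborel \<partial>lborel)"
    by (intro nn_integral_mono)
      (auto simp: f_def g_def T_def u_def unit_triangle_def indicator_def)
  also have "\<dots> = ennreal (1 / ((p + 1) * (p + 2)))"
    by (rule nn_integral_length_powr_triangle[OF assms])
  also have "(\<integral>\<^sup>+a. \<integral>\<^sup>+b. g a b \<partial>lborel \<partial>lborel) = ennreal ((1/3) powr (p + 2) / ((p + 1) * (p + 2)))"
    using nn_integral_length_powr_on_subinterval[OF assms, of u "u + 1/3"] unfolding g_def T_def by simp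
  finally have "(\<integral>\<^sup>+a. \<integral>\<^sup>+b. f a b \<partial>lborel \<partial>lborel) \<le>
      ennreal (1 / ((p + 1) * (p + 2))) - ennreal ((1/3) powr (p + 2) / ((p + 1) * (p + 2)))"
    by (metis ennreal_le_minus_iff ennreal_neq_top add.commute)
  also have "\<dots> = ennreal ((1 - (1/3) powr (p + 2)) / ((p + 1) * (p + 2)))"
    using assms by (subst ennreal_minus) (auto simp: diff_divide_distrib)
  finally show ?thesis by (simp add: f_def)
qed

section \<open>Product integrals over the set of boxes\<close>

lemma sigma_finite_leb: "sigma_finite_measure (leb d)"
proof -
  interpret product_sigma_finite "\<lambda>_::nat. lborel :: real measure" ..
  show ?thesis unfolding leb_def by (rule sigma_finite) simp
qed

lemma coordinate_borel: "j < d \<Longrightarrow> (\<lambda>x. x j) \<in> borel_measurable (leb d)"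
  unfolding leb_def by (metis lessThan_iff measurable_component_singleton measurable_lborel1)

lemma space_leb: "space (leb d) = extensional {..<d}"
  by (auto simp: leb_def space_PiM PiE_UNIV_domain PiE_def)

lemma mem_boxes_iff:
  assumes "z \<in> space (leb d \<Otimes>\<^sub>M leb d)"
  shows "z \<in> boxes d \<longleftrightarrow> (\<forall>j<d. (fst z j, snd z j) \<in> unit_triangle)"
proof -
  obtain a b where z: "z = (a, b)" "a \<in> extensional {..<d}" "b \<in> extensional {..<d}"
    using assms by (cases z) (auto simp: space_pair_measure space_leb)
  show ?thesis
    unfolding z boxes_def unit_cube_def unit_triangle_def using z(2,3)
    by (force simp: PiE_iff intro: order_trans)
qed

lemma boxes_sets [measurable]: "boxes d \<in> sets (leb d \<Otimes>\<^sub>M leb d)"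
proof -
  note coordinate_borel[measurable]
  have "boxes d \<subseteq> space (leb d \<Otimes>\<^sub>M leb d)"
    by (auto simp: boxes_def unit_cube_def space_pair_measure space_leb PiE_def)
  then have "boxes d = {z \<in> space (leb d \<Otimes>\<^sub>M leb d). \<forall>j\<in>{..<d}. (fst z j, snd z j) \<in> unit_triangle}"
    using mem_boxes_iff by auto
  also have "\<dots> \<in> sets (leb d \<Otimes>\<^sub>M leb d)"
    by measurable
  finally show ?thesis .
qed

lemma space_leb_boxes: "space (leb_boxes d) = boxes d"
  using sets.sets_into_space[OF boxes_sets] by (auto simp: leb_boxes_def space_restrict_space)

lemma emeasure_box_cl:
  assumes "\<And>j. j < d \<Longrightarrow> a j \<le> b j"
  shows "emeasure (leb d) (box_cl d a b) = ennreal (\<Prod>j<d. b j - a j)"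
proof -
  interpret product_sigma_finite "\<lambda>_::nat. lborel :: real measure" ..
  have "emeasure (leb d) (box_cl d a b) = (\<Prod>j<d. emeasure lborel {a j..b j})"
    unfolding leb_def box_cl_def by (rule emeasure_PiM) auto
  also have "\<dots> = (\<Prod>j<d. ennreal (b j - a j))"
    using assms by (intro prod.cong) auto
  also have "\<dots> = ennreal (\<Prod>j<d. b j - a j)"
    using assms by (intro prod_ennreal) auto
  finally show ?thesis .
qed

lemma box_cl_sets: "box_cl d a b \<in> sets (leb d)"
  unfolding box_cl_def leb_def by (intro sets_PiM_I_finite) auto

lemma finite_measure_leb_boxes: "finite_measure (leb_boxes d)"
proof
  interpret leb: sigma_finite_measure "leb d" by (rule sigma_finite_leb)
  have cube: "unit_cube d = box_cl d (\<lambda>_. 0) (\<lambda>_. 1)"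
    by (simp add: unit_cube_def box_cl_def)
  have "emeasure (leb_boxes d) (space (leb_boxes d)) = emeasure (leb d \<Otimes>\<^sub>M leb d) (boxes d)"
    unfolding space_leb_boxes by (simp add: leb_boxes_def emeasure_restrict_space)
  also have "\<dots> \<le> emeasure (leb d \<Otimes>\<^sub>M leb d) (unit_cube d \<times> unit_cube d)"
    by (intro emeasure_mono) (auto simp: boxes_def cube box_cl_sets)
  also have "\<dots> = 1"
    by (simp add: leb.emeasure_pair_measure_Times cube box_cl_sets emeasure_box_cl)
  finally show "emeasure (leb_boxes d) (space (leb_boxes d)) \<noteq> \<infinity>"
    using ennreal_one_less_top by (auto simp: top_unique)
qed

text \<open>
  Membership in \<open>boxes d\<close> is a condition on each pair of coordinates \<open>(a j, b j)\<close> separately, so an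
  integrand of product form factorises. The measure is a product of two \<open>d\<close>-fold products, not a
  \<open>d\<close>-fold product of planes; Tonelli for the pair and then for the coordinates regroups it.
\<close>

lemma nn_integral_leb_boxes_prod:
  fixes \<phi> :: "nat \<Rightarrow> real \<Rightarrow> real \<Rightarrow> ennreal"
  assumes [measurable]: "\<And>j. j < d \<Longrightarrow> case_prod (\<phi> j) \<in> borel_measurable (lborel \<Otimes>\<^sub>M lborel)"
  shows "(\<integral>\<^sup>+z. (\<Prod>j<d. \<phi> j (fst z j) (snd z j)) \<partial>leb_boxes d)
    = (\<Prod>j<d. \<integral>\<^sup>+a. \<integral>\<^sup>+b. \<phi> j a b * indicator unit_triangle (a, b) \<partial>lborel \<partial>lborel)"
proof -
  interpret product_sigma_finite "\<lambda>_::nat. lborel :: real measure" ..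
  interpret leb: sigma_finite_measure "leb d" by (rule sigma_finite_leb)
  define \<psi> where "\<psi> j a b = \<phi> j a b * indicator unit_triangle (a, b)" for j a b
  have \<psi>: "case_prod (\<psi> j) \<in> borel_measurable (lborel \<Otimes>\<^sub>M lborel)" if "j < d" for j
    using that unfolding \<psi>_def split_beta' by measurable
  have \<psi>_coord: "(\<lambda>z. \<psi> j (fst z j) (snd z j)) \<in> borel_measurable (leb d \<Otimes>\<^sub>M leb d)" if "j < d" for j
  proof -
    note c = coordinate_borel[OF that]
    have "(\<lambda>z. (fst z j, snd z j)) \<in> (leb d \<Otimes>\<^sub>M leb d) \<rightarrow>\<^sub>M (lborel \<Otimes>\<^sub>M lborel)"
      using measurable_compose[OF measurable_fst c] measurable_compose[OF measurable_snd c]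
      by (intro measurable_Pair) auto
    from measurable_compose[OF this \<psi>[OF that]] show ?thesis by simp
  qed
  have "(\<integral>\<^sup>+z. (\<Prod>j<d. \<phi> j (fst z j) (snd z j)) \<partial>leb_boxes d)
      = (\<integral>\<^sup>+z. (\<Prod>j<d. \<phi> j (fst z j) (snd z j)) * indicator (boxes d) z \<partial>(leb d \<Otimes>\<^sub>M leb d))"
    unfolding leb_boxes_def by (rule nn_integral_restrict_space) simp
  also have "\<dots> = (\<integral>\<^sup>+z. (\<Prod>j<d. \<psi> j (fst z j) (snd z j)) \<partial>(leb d \<Otimes>\<^sub>M leb d))"
  proof (rule nn_integral_cong)
    fix z assume z: "z \<in> space (leb d \<Otimes>\<^sub>M leb d)"
    have "indicator (boxes d) z = (\<Prod>j<d. indicator unit_triangle (fst z j, snd z j) :: ennreal)"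
    proof (cases "z \<in> boxes d")
      case True
      then show ?thesis using mem_boxes_iff[OF z] by simp
    next
      case False
      then obtain j where "j < d" "(fst z j, snd z j) \<notin> unit_triangle"
        using mem_boxes_iff[OF z] by auto
      then have "(\<Prod>j<d. indicator unit_triangle (fst z j, snd z j) :: ennreal) = 0"
        by (intro prod_zero) (auto intro!: bexI[of _ j])
      then show ?thesis using False by simp
    qed
    then show "(\<Prod>j<d. \<phi> j (fst z j) (snd z j)) * indicator (boxes d) z
        = (\<Prod>j<d. \<psi> j (fst z j) (snd z j))"
      by (simp add: \<psi>_def prod.distrib)
  qed
  also have "\<dots> = (\<integral>\<^sup>+a. \<integral>\<^sup>+b. (\<Prod>j<d. \<psi> j (a j) (b j)) \<partial>leb d \<partial>leb d)"
    using leb.nn_integral_fst[of "\<lambda>z. \<Prod>j<d. \<psi> j (fst z j) (snd z j)" "leb d"] \<psi>_coord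
    by (simp add: borel_measurable_prod_ennreal)
  also have "\<dots> = (\<integral>\<^sup>+a. (\<Prod>j<d. \<integral>\<^sup>+b. \<psi> j (a j) b \<partial>lborel) \<partial>leb d)"
  proof (rule nn_integral_cong)
    fix a
    show "(\<integral>\<^sup>+b. (\<Prod>j<d. \<psi> j (a j) (b j)) \<partial>leb d) = (\<Prod>j<d. \<integral>\<^sup>+b. \<psi> j (a j) b \<partial>lborel)"
      unfolding leb_def
    proof (rule product_nn_integral_prod)
      fix j assume "j \<in> {..<d}"
      then show "\<psi> j (a j) \<in> borel_measurable lborel"
        using measurable_compose[OF _ \<psi>, of "Pair (a j)" lborel j] by simp
    qed simp
  qed
  also have "\<dots> = (\<Prod>j<d. \<integral>\<^sup>+a. \<integral>\<^sup>+b. \<psi> j a b \<partial>lborel \<partial>lborel)"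
    unfolding leb_def
  proof (rule product_nn_integral_prod)
    fix j assume "j \<in> {..<d}"
    then have [measurable]: "case_prod (\<psi> j) \<in> borel_measurable (lborel \<Otimes>\<^sub>M lborel)"
      using \<psi> by simp
    show "(\<lambda>a. \<integral>\<^sup>+b. \<psi> j a b \<partial>lborel) \<in> borel_measurable lborel"
      by measurable
  qed simp
  finally show ?thesis by (simp add: \<psi>_def)
qed

section \<open>The volume function and the boxes that miss all points\<close>

definition box_vol :: "nat \<Rightarrow> point \<times> point \<Rightarrow> real" where
  "box_vol d z = (\<Prod>j<d. snd z j - fst z j)"

lemma box_vol_bounds:
  assumes "z \<in> boxes d"
  shows "0 \<le> box_vol d z" "box_vol d z \<le> 1"
proof -
  have *: "0 \<le> snd z j - fst z j \<and> snd z j - fst z j \<le> 1" if "j < d" for j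
    using assms that by (force simp: boxes_def unit_cube_def PiE_iff)
  show "0 \<le> box_vol d z"
    unfolding box_vol_def using * by (intro prod_nonneg) auto
  show "box_vol d z \<le> 1"
    unfolding box_vol_def using * by (intro prod_le_1) auto
qed

lemma coordinate_leb_boxes_borel:
  assumes "j < d"
  shows "(\<lambda>z. fst z j) \<in> borel_measurable (leb_boxes d)"
    and "(\<lambda>z. snd z j) \<in> borel_measurable (leb_boxes d)"
  unfolding leb_boxes_def
  by (intro measurable_restrict_space1 measurable_compose[OF measurable_fst coordinate_borel[OF assms]]
      measurable_compose[OF measurable_snd coordinate_borel[OF assms]])+

lemma box_vol_borel [measurable]: "box_vol d \<in> borel_measurable (leb_boxes d)"
  unfolding box_vol_def[abs_def]
  using coordinate_leb_boxes_borel by (intro borel_measurable_prod borel_measurable_diff) auto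

lemma mem_box_cl_iff:
  "x \<in> extensional {..<d} \<Longrightarrow> x \<in> box_cl d a b \<longleftrightarrow> (\<forall>j\<in>{..<d}. a j \<le> x j \<and> x j \<le> b j)"
  by (auto simp: box_cl_def PiE_iff)

lemma mem_box_ho_iff:
  "x \<in> extensional {..<d} \<Longrightarrow> x \<in> box_ho d a b \<longleftrightarrow> (\<forall>j\<in>{..<d}. a j \<le> x j \<and> x j < b j)"
  by (auto simp: box_ho_def PiE_iff)

lemma indicator_box_ho_borel:
  assumes "x \<in> extensional {..<d}"
  shows "(\<lambda>z. indicator (box_ho d (fst z) (snd z)) x :: real) \<in> borel_measurable (leb_boxes d)"
proof -
  note coordinate_leb_boxes_borel[measurable]
  show ?thesis
    unfolding indicator_def mem_box_ho_iff[OF assms] by measurable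
qed

text \<open>
  Closed boxes are used because they serve both problems: \<open>T_op\<close> integrates over boxes whose closure
  contains the point, while the discrepancy counts points in half-open boxes, and a point missed by the
  closed box is missed by the half-open one.
\<close>

definition missing_boxes :: "nat \<Rightarrow> point set \<Rightarrow> (point \<times> point) set" where
  "missing_boxes d P = {(a, b) \<in> boxes d. box_cl d a b \<inter> P = {}}"

lemma missing_boxes_sets [measurable]:
  assumes "finite P" "P \<subseteq> unit_cube d"
  shows "missing_boxes d P \<in> sets (leb_boxes d)"
proof -
  note coordinate_leb_boxes_borel[measurable]
  have *: "x \<in> extensional {..<d}" if "x \<in> P" for x
    using assms that by (auto simp: unit_cube_def PiE_iff)
  have "missing_boxes d P = {z \<in> space (leb_boxes d).
      \<forall>x\<in>P. \<not> (\<forall>j\<in>{..<d}. fst z j \<le> x j \<and> x j \<le> snd z j)}"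
    using mem_box_cl_iff[OF *] by (fastforce simp: missing_boxes_def space_leb_boxes)
  also have "\<dots> \<in> sets (leb_boxes d)"
    using \<open>finite P\<close> by measurable
  finally show ?thesis .
qed

lemma prod_powr:
  fixes f :: "'a \<Rightarrow> real"
  assumes "\<And>i. i \<in> A \<Longrightarrow> 0 \<le> f i"
  shows "(\<Prod>i\<in>A. f i) powr p = (\<Prod>i\<in>A. f i powr p)"
  using assms by (induction A rule: infinite_finite_induct) (auto simp: powr_mult prod_nonneg)

lemma ennreal_box_vol_powr:
  assumes "z \<in> boxes d"
  shows "ennreal (box_vol d z powr p) = (\<Prod>j<d. ennreal ((snd z j - fst z j) powr p))"
proof -
  have "box_vol d z powr p = (\<Prod>j<d. (snd z j - fst z j) powr p)"
    unfolding box_vol_def using assms by (intro prod_powr) (auto simp: boxes_def)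
  then show ?thesis by (simp add: prod_ennreal)
qed

lemma nn_integral_box_vol_powr:
  fixes p :: real
  assumes "0 < p"
  shows "(\<integral>\<^sup>+z. ennreal (box_vol d z powr p) \<partial>leb_boxes d) = ennreal ((1 / ((p + 1) * (p + 2))) ^ d)"
proof -
  have "(\<integral>\<^sup>+z. ennreal (box_vol d z powr p) \<partial>leb_boxes d)
      = (\<integral>\<^sup>+z. (\<Prod>j<d. ennreal ((snd z j - fst z j) powr p)) \<partial>leb_boxes d)"
    by (intro nn_integral_cong ennreal_box_vol_powr) (simp add: space_leb_boxes)
  also have "\<dots> = (\<Prod>j<d. ennreal (1 / ((p + 1) * (p + 2))))"
    using assms by (subst nn_integral_leb_boxes_prod[where \<phi>="\<lambda>_ a b. ennreal ((b - a) powr p)"])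
      (auto simp: nn_integral_length_powr_triangle)
  also have "\<dots> = ennreal ((1 / ((p + 1) * (p + 2))) ^ d)"
    using assms by (simp add: ennreal_power)
  finally show ?thesis .
qed

text \<open>
  A box contains \<open>x\<close> iff each of its sides contains the coordinate of \<open>x\<close>, so the one-dimensional loss
  factor occurs once per coordinate. This is where the exponential dependence on \<open>d\<close> comes from.
\<close>

lemma nn_integral_box_vol_powr_containing_le:
  fixes p :: real
  assumes "0 < p" "x \<in> unit_cube d"
  shows "(\<integral>\<^sup>+z. ennreal (box_vol d z powr p) * indicator (box_cl d (fst z) (snd z)) x \<partial>leb_boxes d)
    \<le> ennreal (((1 - (1/3) powr (p + 2)) / ((p + 1) * (p + 2))) ^ d)"
proof -
  have x: "x \<in> extensional {..<d}"
    using assms by (auto simp: unit_cube_def PiE_iff)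
  have ind: "indicator (box_cl d a b) x = (\<Prod>j<d. indicator {a j..b j} (x j) :: ennreal)" for a b
    using mem_box_cl_iff[OF x] by (auto simp: indicator_def intro!: prod_zero)
  have "(\<integral>\<^sup>+z. ennreal (box_vol d z powr p) * indicator (box_cl d (fst z) (snd z)) x \<partial>leb_boxes d)
      = (\<integral>\<^sup>+z. (\<Prod>j<d. ennreal ((snd z j - fst z j) powr p) * indicator {fst z j..snd z j} (x j)) \<partial>leb_boxes d)"
    by (intro nn_integral_cong)
      (simp add: space_leb_boxes ennreal_box_vol_powr ind prod.distrib)
  also have "\<dots> = (\<Prod>j<d. \<integral>\<^sup>+a. \<integral>\<^sup>+b. ennreal ((b - a) powr p) * indicator {a..b} (x j)
      * indicator unit_triangle (a, b) \<partial>lborel \<partial>lborel)"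
    by (rule nn_integral_leb_boxes_prod
        [where \<phi>="\<lambda>j a b. ennreal ((b - a) powr p) * indicator {a..b} (x j)"])
      (unfold split_beta' indicator_def atLeastAtMost_iff, measurable)
  also have "\<dots> \<le> (\<Prod>j<d. ennreal ((1 - (1/3) powr (p + 2)) / ((p + 1) * (p + 2))))"
    using assms by (intro prod_mono_ennreal nn_integral_length_powr_containing) auto
  also have "\<dots> = ennreal (((1 - (1/3) powr (p + 2)) / ((p + 1) * (p + 2))) ^ d)"
    using assms by (simp add: ennreal_power powr_le1)
  finally show ?thesis .
qed

lemma integrable_box_vol_powr:
  assumes "0 < p"
  shows "integrable (leb_boxes d) (\<lambda>z. box_vol d z powr p)"
  using nn_integral_box_vol_powr[OF assms, of d]
  by (intro integrableI_nonneg) auto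

lemma integral_box_vol_powr:
  assumes "0 < p"
  shows "(\<integral>z. box_vol d z powr p \<partial>leb_boxes d) = (1 / ((p + 1) * (p + 2))) ^ d"
  using nn_integral_box_vol_powr[OF assms, of d] assms
  by (intro integral_eq_nn_integral[THEN trans]) auto

text \<open>
  A union bound: the boxes hit by \<open>P\<close> are covered by the boxes containing a single point, one family
  for each point of \<open>P\<close>, and each family carries an exponentially small share of the total \<open>J\<close>.
\<close>

lemma integral_missing_boxes_ge:
  fixes p :: real
  assumes p: "0 < p" and P: "finite P" "P \<subseteq> unit_cube d"
  defines "J \<equiv> (1 / ((p + 1) * (p + 2))) ^ d"
  shows "(1 - real (card P) * (1 - (1/3) powr (p + 2)) ^ d) * J
    \<le> (\<integral>z. box_vol d z powr p * indicator (missing_boxes d P) z \<partial>leb_boxes d)"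
proof -
  note [measurable] = missing_boxes_sets[OF P]
  define A where "A = (\<integral>z. box_vol d z powr p * indicator (missing_boxes d P) z \<partial>leb_boxes d)"
  define \<rho> where "\<rho> = 1 - (1/3 :: real) powr (p + 2)"
  have \<rho>: "0 \<le> \<rho>" using p by (simp add: \<rho>_def powr_le1)
  have "A \<ge> 0" unfolding A_def by (intro Bochner_Integration.integral_nonneg) auto
  have A: "(\<integral>\<^sup>+z. ennreal (box_vol d z powr p * indicator (missing_boxes d P) z) \<partial>leb_boxes d) = ennreal A"
    unfolding A_def
    by (intro nn_integral_eq_integral integrable_real_mult_indicator integrable_box_vol_powr p) auto
  have meas: "(\<lambda>z. indicator (box_cl d (fst z) (snd z)) x :: ennreal) \<in> borel_measurable (leb_boxes d)"
    if "x \<in> P" for x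
  proof -
    note coordinate_leb_boxes_borel[measurable]
    have x: "x \<in> extensional {..<d}" using P that by (auto simp: unit_cube_def PiE_iff)
    show ?thesis unfolding indicator_def mem_box_cl_iff[OF x] by measurable
  qed
  have "ennreal J = (\<integral>\<^sup>+z. ennreal (box_vol d z powr p) \<partial>leb_boxes d)"
    unfolding J_def by (rule nn_integral_box_vol_powr[OF p, symmetric])
  also have "\<dots> \<le> (\<integral>\<^sup>+z. ennreal (box_vol d z powr p * indicator (missing_boxes d P) z)
      + (\<Sum>x\<in>P. ennreal (box_vol d z powr p) * indicator (box_cl d (fst z) (snd z)) x) \<partial>leb_boxes d)"
  proof (rule nn_integral_mono)
    fix z assume "z \<in> space (leb_boxes d)"
    then have z: "z \<in> boxes d" by (simp add: space_leb_boxes)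
    show "ennreal (box_vol d z powr p) \<le> ennreal (box_vol d z powr p * indicator (missing_boxes d P) z)
      + (\<Sum>x\<in>P. ennreal (box_vol d z powr p) * indicator (box_cl d (fst z) (snd z)) x)"
    proof (cases "z \<in> missing_boxes d P")
      case False
      then obtain x where x: "x \<in> P" "x \<in> box_cl d (fst z) (snd z)"
        using z by (auto simp: missing_boxes_def split: prod.splits)
      have "ennreal (box_vol d z powr p) * indicator (box_cl d (fst z) (snd z)) x
          \<le> (\<Sum>x\<in>P. ennreal (box_vol d z powr p) * indicator (box_cl d (fst z) (snd z)) x)"
        using x P by (intro member_le_sum) auto
      then show ?thesis using x False by simp
    qed simp
  qed
  also have "\<dots> = ennreal A + (\<Sum>x\<in>P. \<integral>\<^sup>+z. ennreal (box_vol d z powr p)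
      * indicator (box_cl d (fst z) (snd z)) x \<partial>leb_boxes d)"
    using meas by (simp add: nn_integral_add nn_integral_sum A)
  also have "\<dots> \<le> ennreal A + (\<Sum>x\<in>P. ennreal ((\<rho> / ((p + 1) * (p + 2))) ^ d))"
    unfolding \<rho>_def using P
    by (intro add_left_mono sum_mono nn_integral_box_vol_powr_containing_le p) auto
  also have "\<dots> = ennreal (A + real (card P) * (\<rho> / ((p + 1) * (p + 2))) ^ d)"
    using \<open>A \<ge> 0\<close> \<rho> p by (simp add: ennreal_plus ennreal_mult' ennreal_of_nat_eq_real_of_nat)
  finally have "J \<le> A + real (card P) * (\<rho> / ((p + 1) * (p + 2))) ^ d"
    using \<open>A \<ge> 0\<close> \<rho> p by (subst (asm) ennreal_le_iff) auto
  then show ?thesis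
    by (simp add: A_def J_def \<rho>_def algebra_simps power_divide)
qed

lemma integrable_box_vol_powr_missing:
  assumes "0 < p" "finite P" "P \<subseteq> unit_cube d"
  shows "integrable (leb_boxes d) (\<lambda>z. box_vol d z powr p * indicator (missing_boxes d P) z)"
  by (intro integrable_real_mult_indicator integrable_box_vol_powr missing_boxes_sets assms)

section \<open>Discrepancy on the missing boxes\<close>

text \<open>
  The \<open>L\<^sub>p\<close> norm of the volume function restricted to the missing boxes. Both the discrepancy and the
  integration error are bounded below by it.
\<close>

definition missing_norm :: "nat \<Rightarrow> real \<Rightarrow> point set \<Rightarrow> real" where
  "missing_norm d p P =
    (\<integral>z. box_vol d z powr p * indicator (missing_boxes d P) z \<partial>leb_boxes d) powr (1 / p)"

lemma unit_cube_ho_subset: "unit_cube_ho d \<subseteq> unit_cube d"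
  unfolding unit_cube_ho_def unit_cube_def by (intro PiE_mono) auto

text \<open>
  On a box without points the local discrepancy is minus the volume of the box.
\<close>

lemma missing_norm_le_L_ext:
  fixes p :: real
  assumes p: "0 < p" and P: "finite P" "P \<subseteq> unit_cube d"
  shows "missing_norm d p P \<le> L_ext d p P w"
proof -
  interpret finite_measure "leb_boxes d" by (rule finite_measure_leb_boxes)
  define h where "h z = (\<Sum>x\<in>P. w x * indicator (box_ho d (fst z) (snd z)) x) - box_vol d z" for z
  have [measurable]: "h \<in> borel_measurable (leb_boxes d)"
    unfolding h_def[abs_def] using P
    by (intro borel_measurable_diff borel_measurable_sum borel_measurable_times box_vol_borel
        indicator_box_ho_borel) (auto simp: unit_cube_def PiE_iff)
  have "integrable (leb_boxes d) (\<lambda>z. \<bar>h z\<bar> powr p)"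
  proof (rule integrable_const_bound)
    show "AE z in leb_boxes d. norm (\<bar>h z\<bar> powr p) \<le> ((\<Sum>x\<in>P. \<bar>w x\<bar>) + 1) powr p"
    proof (rule AE_I2)
      fix z assume "z \<in> space (leb_boxes d)"
      then have z: "z \<in> boxes d" by (simp add: space_leb_boxes)
      have "\<bar>h z\<bar> \<le> \<bar>\<Sum>x\<in>P. w x * indicator (box_ho d (fst z) (snd z)) x\<bar> + 1"
        using box_vol_bounds[OF z] unfolding h_def by linarith
      also have "\<bar>\<Sum>x\<in>P. w x * indicator (box_ho d (fst z) (snd z)) x\<bar> \<le> (\<Sum>x\<in>P. \<bar>w x\<bar>)"
        by (intro order_trans[OF sum_abs] sum_mono) (auto simp: indicator_def)
      finally show "norm (\<bar>h z\<bar> powr p) \<le> ((\<Sum>x\<in>P. \<bar>w x\<bar>) + 1) powr p"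
        using p by (simp add: powr_mono2)
    qed
  qed measurable
  then have "(\<integral>z. box_vol d z powr p * indicator (missing_boxes d P) z \<partial>leb_boxes d)
    \<le> (\<integral>z. \<bar>h z\<bar> powr p \<partial>leb_boxes d)"
  proof (rule integral_mono[OF integrable_box_vol_powr_missing[OF assms]])
    fix z assume "z \<in> space (leb_boxes d)"
    then have z: "z \<in> boxes d" by (simp add: space_leb_boxes)
    show "box_vol d z powr p * indicator (missing_boxes d P) z \<le> \<bar>h z\<bar> powr p"
    proof (cases "z \<in> missing_boxes d P")
      case True
      have "box_ho d (fst z) (snd z) \<subseteq> box_cl d (fst z) (snd z)"
        unfolding box_ho_def box_cl_def by (intro PiE_mono) auto
      then have "\<forall>x\<in>P. x \<notin> box_ho d (fst z) (snd z)"
        using True by (fastforce simp: missing_boxes_def)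
      then have "h z = - box_vol d z" by (simp add: h_def)
      then show ?thesis using True box_vol_bounds[OF z] by simp
    qed simp
  qed
  moreover have "L_ext d p P w = (\<integral>z. \<bar>h z\<bar> powr p \<partial>leb_boxes d) powr (1 / p)"
    by (simp add: L_ext_def h_def box_vol_def split_beta')
  ultimately show ?thesis
    using p unfolding missing_norm_def
    by (auto intro!: powr_mono2 Bochner_Integration.integral_nonneg)
qed

section \<open>Integration as a pairing with the volume function\<close>

lemma indicator_box_cl_pair_borel:
  "(\<lambda>(z, x). indicator (box_cl d (fst z) (snd z)) x :: real) \<in> borel_measurable (leb_boxes d \<Otimes>\<^sub>M leb d)"
proof -
  have 1: "(\<lambda>w. fst (fst w) j) \<in> borel_measurable (leb_boxes d \<Otimes>\<^sub>M leb d)"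
    and 2: "(\<lambda>w. snd (fst w) j) \<in> borel_measurable (leb_boxes d \<Otimes>\<^sub>M leb d)"
    and 3: "(\<lambda>w. snd w j) \<in> borel_measurable (leb_boxes d \<Otimes>\<^sub>M leb d)" if "j < d" for j
    using that by (intro measurable_compose[OF measurable_fst coordinate_leb_boxes_borel(1)]
        measurable_compose[OF measurable_fst coordinate_leb_boxes_borel(2)]
        measurable_compose[OF measurable_snd coordinate_borel]; simp)+
  note [measurable] = 1 2 3
  have "(\<lambda>w. of_bool (\<forall>j\<in>{..<d}. fst (fst w) j \<le> snd w j \<and> snd w j \<le> snd (fst w) j) :: real)
      \<in> borel_measurable (leb_boxes d \<Otimes>\<^sub>M leb d)"
    by measurable
  then show ?thesis
    by (rule measurable_cong[THEN iffD1, rotated])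
      (auto simp: space_pair_measure space_leb mem_box_cl_iff indicator_def)
qed

lemma box_cl_subset_unit_cube:
  assumes "(a, b) \<in> boxes d"
  shows "box_cl d a b \<subseteq> unit_cube d"
  unfolding box_cl_def unit_cube_def
proof (rule PiE_mono)
  fix j assume "j \<in> {..<d}"
  then have "0 \<le> a j" "b j \<le> 1"
    using assms by (auto simp: boxes_def unit_cube_def PiE_iff)
  then show "{a j..b j} \<subseteq> {0..1}" by auto
qed

text \<open>
  Fubini: integrating over the cube turns the indicator of a box into its volume. Hence integration
  in \<open>F_space\<close> is the pairing of the coefficient function with \<open>box_vol\<close>.
\<close>

lemma Int_cube_T_op:
  assumes c: "integrable (leb_boxes d) c"
  shows "Int_cube d (T_op d c) = (\<integral>z. c z * box_vol d z \<partial>leb_boxes d)"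
proof -
  interpret B: finite_measure "leb_boxes d" by (rule finite_measure_leb_boxes)
  interpret L: sigma_finite_measure "leb d" by (rule sigma_finite_leb)
  interpret BL: pair_sigma_finite "leb_boxes d" "leb d" ..
  note [measurable] = borel_measurable_integrable[OF c] indicator_box_cl_pair_borel
  define f where "f z x = c z * indicator (box_cl d (fst z) (snd z)) x" for z x
  have vol: "measure (leb d) (box_cl d (fst z) (snd z) \<inter> space (leb d)) = box_vol d z"
    "integrable (leb d) (indicator (box_cl d (fst z) (snd z)) :: point \<Rightarrow> real)"
    if z: "z \<in> space (leb_boxes d)" for z
  proof -
    have e: "emeasure (leb d) (box_cl d (fst z) (snd z)) = ennreal (box_vol d z)"
      using z unfolding box_vol_def
      by (intro emeasure_box_cl) (auto simp: space_leb_boxes boxes_def)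
    show "measure (leb d) (box_cl d (fst z) (snd z) \<inter> space (leb d)) = box_vol d z"
      using e box_vol_bounds(1)[of z d] z box_cl_sets
      by (simp add: measure_def space_leb_boxes Int_absorb2 sets.sets_into_space)
    show "integrable (leb d) (indicator (box_cl d (fst z) (snd z)) :: point \<Rightarrow> real)"
      using e box_cl_sets by (simp add: integrable_indicator_iff Int_absorb2 sets.sets_into_space)
  qed
  have f_meas: "case_prod f \<in> borel_measurable (leb_boxes d \<Otimes>\<^sub>M leb d)"
    using indicator_box_cl_pair_borel unfolding f_def split_beta' by measurable
  have f_int: "integrable (leb_boxes d \<Otimes>\<^sub>M leb d) (case_prod f)"
  proof (rule BL.Fubini_integrable[OF f_meas])
    have "integrable (leb_boxes d) (\<lambda>z. \<bar>c z\<bar> * box_vol d z)"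
      using c
    proof (rule Bochner_Integration.integrable_bound)
      show "AE z in leb_boxes d. norm (\<bar>c z\<bar> * box_vol d z) \<le> norm (c z)"
        using box_vol_bounds by (intro AE_I2) (auto simp: space_leb_boxes abs_mult mult_left_le)
    qed measurable
    then show "integrable (leb_boxes d) (\<lambda>z. \<integral>x. norm (case (z, x) of (z, x) \<Rightarrow> f z x) \<partial>leb d)"
      by (rule Bochner_Integration.integrable_cong[THEN iffD1, rotated -1]) (auto simp: f_def abs_mult vol)
    show "AE z in leb_boxes d. integrable (leb d) (\<lambda>x. case (z, x) of (z, x) \<Rightarrow> f z x)"
      unfolding f_def by (intro AE_I2) (auto intro!: vol)
  qed
  have "Int_cube d (T_op d c) = (\<integral>x. (\<integral>z. f z x \<partial>leb_boxes d) \<partial>leb d)"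
    unfolding Int_cube_def set_lebesgue_integral_def
  proof (rule Bochner_Integration.integral_cong[OF refl])
    fix x
    show "indicat_real (unit_cube d) x *\<^sub>R T_op d c x = (\<integral>z. f z x \<partial>leb_boxes d)"
    proof (cases "x \<in> unit_cube d")
      case True
      then show ?thesis by (simp add: T_op_def f_def split_beta')
    next
      case False
      have "f z x = 0" if "z \<in> space (leb_boxes d)" for z
        using that False box_cl_subset_unit_cube[of "fst z" "snd z" d]
        by (auto simp: f_def space_leb_boxes indicator_def)
      then show ?thesis using False by (simp cong: Bochner_Integration.integral_cong)
    qed
  qed
  also have "\<dots> = (\<integral>z. (\<integral>x. f z x \<partial>leb d) \<partial>leb_boxes d)"
    by (rule BL.Fubini_integral[OF f_int])
  also have "\<dots> = (\<integral>z. c z * box_vol d z \<partial>leb_boxes d)"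
    by (intro Bochner_Integration.integral_cong) (auto simp: f_def vol)
  finally show ?thesis .
qed

lemma integrable_of_Lq:
  assumes "1 \<le> q" "c \<in> Lq d q"
  shows "integrable (leb_boxes d) c"
proof -
  interpret finite_measure "leb_boxes d" by (rule finite_measure_leb_boxes)
  have "integrable (leb_boxes d) (\<lambda>z. 1 + \<bar>c z\<bar> powr q)"
    using assms by (simp add: Lq_def)
  then show ?thesis
  proof (rule Bochner_Integration.integrable_bound)
    have "t \<le> 1 + t powr q" if "t \<ge> 0" for t :: real
    proof (cases "t \<le> 1")
      case False
      then show ?thesis using powr_mono[of 1 q t] assms by simp
    qed (auto intro: order_trans)
    then show "AE z in leb_boxes d. norm (c z) \<le> norm (1 + \<bar>c z\<bar> powr q)"
      by (intro AE_I2) (auto simp: abs_of_nonneg add_nonneg_nonneg)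
  qed (use assms in \<open>auto simp: Lq_def\<close>)
qed

section \<open>Initial error and fooling functions\<close>

text \<open>
  Hoelder's inequality in normalised form, by integrating Young's inequality for \<open>f / s\<close> and \<open>g / t\<close>.
  Only upper bounds \<open>s\<close> and \<open>t\<close> for the two norms enter, so vanishing norms need no special treatment.
\<close>

lemma abs_integral_mult_le_Holder:
  fixes f g :: "'a \<Rightarrow> real"
  assumes pq: "1 < p" "1 < q" "1 / p + 1 / q = 1"
    and f: "integrable M (\<lambda>x. \<bar>f x\<bar> powr q)" "(\<integral>x. \<bar>f x\<bar> powr q \<partial>M) \<le> s powr q" "0 < s"
    and g: "integrable M (\<lambda>x. \<bar>g x\<bar> powr p)" "(\<integral>x. \<bar>g x\<bar> powr p \<partial>M) \<le> t powr p" "0 < t"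
  shows "\<bar>\<integral>x. f x * g x \<partial>M\<bar> \<le> s * t"
proof -
  let ?F = "\<lambda>x. \<bar>f x\<bar> powr q / s powr q / q" and ?G = "\<lambda>x. \<bar>g x\<bar> powr p / t powr p / p"
  have "(\<integral>x. \<bar>f x * g x\<bar> / (s * t) \<partial>M) \<le> (\<integral>x. ?F x + ?G x \<partial>M)"
  proof (rule integral_mono')
    show "integrable M (\<lambda>x. ?F x + ?G x)"
      using f(1) g(1) by simp
    show "\<bar>f x * g x\<bar> / (s * t) \<le> ?F x + ?G x" for x
      using Youngs_inequality[of q p "\<bar>f x\<bar> / s" "\<bar>g x\<bar> / t"] pq f(3) g(3)
      by (simp add: powr_divide abs_mult add.commute)
    show "0 \<le> ?F x + ?G x" for x
      using pq by (intro add_nonneg_nonneg) auto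
  qed
  also have "\<dots> = (\<integral>x. \<bar>f x\<bar> powr q \<partial>M) / s powr q / q + (\<integral>x. \<bar>g x\<bar> powr p \<partial>M) / t powr p / p"
    using f(1) g(1) by simp
  also have "\<dots> \<le> 1 / q + 1 / p"
    using f g pq by (intro add_mono divide_right_mono) auto
  finally have "(\<integral>x. \<bar>f x * g x\<bar> \<partial>M) \<le> s * t"
    using pq f(3) g(3) by (simp add: add.commute field_simps)
  then show ?thesis
    using integral_abs_bound[of M "\<lambda>x. f x * g x"] by linarith
qed

lemma L_ext_initial_eq:
  assumes "0 < p"
  shows "L_ext_initial p d = ((1 / ((p + 1) * (p + 2))) ^ d) powr (1 / p)"
proof -
  have "(1 / ((p + 1) * (p + 2))) ^ d = ((p + 1) * (p + 2)) powr (- real d)"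
    using assms by (simp add: powr_minus_divide powr_realpow power_one_over)
  then show ?thesis
    by (simp add: L_ext_initial_def powr_powr)
qed

text \<open>
  By the pairing formula and Hoelder's inequality, the initial error is at most the \<open>L\<^sub>p\<close> norm of
  \<open>box_vol\<close>, which is the initial discrepancy. The infimum that defines \<open>box_norm\<close> may not be attained,
  so a representation of norm below \<open>s\<close> is chosen for each \<open>s > 1\<close>, and \<open>s\<close> tends to \<open>1\<close> at the end.
\<close>

lemma initial_error_le:
  fixes p q :: real
  assumes pq: "1 < p" "1 < q" "1 / p + 1 / q = 1"
  shows "initial_error q d \<le> ereal (L_ext_initial p d)"
  unfolding initial_error_def wc_error_def
proof (rule SUP_least)
  fix f assume "f \<in> {f \<in> F_space d q. box_norm d q f \<le> 1}"
  then obtain c0 where c0: "c0 \<in> Lq d q" "f = T_op d c0" and norm: "box_norm d q f \<le> 1"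
    by (auto simp: F_space_def)
  define t where "t = L_ext_initial p d"
  have t: "t > 0" "t powr p = (1 / ((p + 1) * (p + 2))) ^ d"
    using pq by (auto simp: t_def L_ext_initial_eq powr_powr)
  have "\<bar>Int_cube d f\<bar> \<le> s * t" if "s > 1" for s
  proof -
    have "Inf {Lq_norm d q c | c. c \<in> Lq d q \<and> f = T_op d c} < s"
      using norm that by (simp add: box_norm_def)
    then obtain c where c: "c \<in> Lq d q" "f = T_op d c" "Lq_norm d q c < s"
      using c0 by (subst (asm) cInf_less_iff) (auto intro!: bdd_belowI[of _ 0] simp: Lq_norm_def)
    have "(Lq_norm d q c) powr q = (\<integral>z. \<bar>c z\<bar> powr q \<partial>leb_boxes d)"
      using pq by (simp add: Lq_norm_def powr_powr Bochner_Integration.integral_nonneg)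
    moreover have "(Lq_norm d q c) powr q \<le> s powr q"
      using c pq by (intro powr_mono2) (auto simp: Lq_norm_def)
    ultimately have c_le: "(\<integral>z. \<bar>c z\<bar> powr q \<partial>leb_boxes d) \<le> s powr q" by simp
    have "\<bar>\<integral>z. c z * box_vol d z \<partial>leb_boxes d\<bar> \<le> s * t"
    proof (rule abs_integral_mult_le_Holder[OF pq _ c_le _ _ _ t(1)])
      have eq: "\<bar>box_vol d z\<bar> powr p = box_vol d z powr p" if "z \<in> space (leb_boxes d)" for z
        using box_vol_bounds[of z d] that by (simp add: space_leb_boxes)
      show "integrable (leb_boxes d) (\<lambda>z. \<bar>box_vol d z\<bar> powr p)"
        using integrable_box_vol_powr[of p d] pq
        by (subst Bochner_Integration.integrable_cong[OF refl eq]) auto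
      have "(\<integral>z. \<bar>box_vol d z\<bar> powr p \<partial>leb_boxes d) = t powr p"
        unfolding t(2) using integral_box_vol_powr[of p d] pq
        by (subst Bochner_Integration.integral_cong[OF refl eq]) auto
      then show "(\<integral>z. \<bar>box_vol d z\<bar> powr p \<partial>leb_boxes d) \<le> t powr p" by simp
    qed (use c that in \<open>auto simp: Lq_def\<close>)
    moreover have "Int_cube d f = (\<integral>z. c z * box_vol d z \<partial>leb_boxes d)"
      unfolding c(2) using c(1) pq by (intro Int_cube_T_op integrable_of_Lq) auto
    ultimately show ?thesis by simp
  qed
  then have "\<bar>Int_cube d f\<bar> / t \<le> s" if "s > 1" for s
    using that t(1) by (simp add: pos_divide_le_eq)
  then have "\<bar>Int_cube d f\<bar> / t \<le> 1"
    by (rule dense_ge)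
  then have "\<bar>Int_cube d f\<bar> \<le> t"
    using t(1) by (simp add: pos_divide_le_eq)
  then show "ereal \<bar>Int_cube d f - 0\<bar> \<le> ereal (L_ext_initial p d)"
    using t(1) by (simp add: t_def)
qed

text \<open>
  The fooling function. Equality in Hoelder's inequality against \<open>box_vol\<close> is attained by multiples of
  \<open>box_vol\<close> to the power \<open>p - 1\<close>; restricting this coefficient function to the missing boxes gives a
  function in the unit ball that vanishes at all points of \<open>P\<close>, so the rule returns \<open>0\<close> whereas the
  integral equals the norm of the restricted volume function.
\<close>

lemma missing_norm_le_wc_error:
  fixes p q :: real
  assumes pq: "1 < p" "1 < q" "1 / p + 1 / q = 1" and P: "finite P" "P \<subseteq> unit_cube d"
  shows "ereal (missing_norm d p P) \<le> wc_error d q (lin_rule P w)"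
proof -
  define A where "A = (\<integral>z. box_vol d z powr p * indicator (missing_boxes d P) z \<partial>leb_boxes d)"
  have int: "integrable (leb_boxes d) (\<lambda>z. box_vol d z powr p * indicator (missing_boxes d P) z)"
    using pq P by (intro integrable_box_vol_powr_missing) auto
  have "A \<ge> 0" unfolding A_def by (intro Bochner_Integration.integral_nonneg) auto
  \<comment> \<open>The factor in \<open>A\<close> makes \<open>c\<close> a unit vector. If \<open>A = 0\<close> it is \<open>0\<close>, and the claim still holds with
    \<open>c = 0\<close>.\<close>
  define c where "c z = A powr (- 1 / q) * (box_vol d z powr (p - 1) * indicator (missing_boxes d P) z)" for z
  have exps: "(p - 1) * q = p" "1 - 1 / q = 1 / p" "q \<noteq> 0"
    using pq by (auto simp: field_simps)
  have [measurable]: "c \<in> borel_measurable (leb_boxes d)"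
    using missing_boxes_sets[OF P] unfolding c_def[abs_def] by measurable
  have c_powr: "\<bar>c z\<bar> powr q = A powr (-1) * (box_vol d z powr p * indicator (missing_boxes d P) z)" for z
    using exps by (simp add: c_def abs_mult powr_mult powr_powr indicator_def)
  have c: "c \<in> Lq d q"
    using int by (simp add: Lq_def c_powr)
  have "(\<integral>z. \<bar>c z\<bar> powr q \<partial>leb_boxes d) = A powr (-1) * A"
    unfolding c_powr A_def by simp
  also have "\<dots> \<le> 1"
    using \<open>A \<ge> 0\<close> by (cases "A = 0") (auto simp: powr_minus)
  finally have "Lq_norm d q c \<le> 1"
    using pq unfolding Lq_norm_def
    by (intro powr_le1) (auto intro!: Bochner_Integration.integral_nonneg)
  then have "box_norm d q (T_op d c) \<le> 1"
    unfolding box_norm_def using c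
    by (intro cInf_lower2[where x="Lq_norm d q c"]) (auto intro!: bdd_belowI[of _ 0] simp: Lq_norm_def)
  moreover have "lin_rule P w (T_op d c) = 0"
  proof -
    have "T_op d c x = 0" if x: "x \<in> P" for x
    proof -
      have "(\<lambda>z. c z * indicator (box_cl d (fst z) (snd z)) x) = (\<lambda>z. 0)"
        using x by (auto simp: fun_eq_iff c_def missing_boxes_def indicator_def)
      moreover have "T_op d c x = (\<integral>z. c z * indicator (box_cl d (fst z) (snd z)) x \<partial>leb_boxes d)"
        using x P by (auto simp: T_op_def split_beta')
      ultimately show ?thesis by simp
    qed
    then show ?thesis by (simp add: lin_rule_def)
  qed
  moreover have "Int_cube d (T_op d c) = A powr (1 / p)"
  proof -
    have "Int_cube d (T_op d c) = (\<integral>z. c z * box_vol d z \<partial>leb_boxes d)"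
      using c pq by (intro Int_cube_T_op integrable_of_Lq) auto
    also have "\<dots> = (\<integral>z. A powr (- 1 / q) * (box_vol d z powr p * indicator (missing_boxes d P) z) \<partial>leb_boxes d)"
    proof (rule Bochner_Integration.integral_cong[OF refl])
      fix z assume "z \<in> space (leb_boxes d)"
      then have "box_vol d z \<ge> 0" using box_vol_bounds by (simp add: space_leb_boxes)
      then have "box_vol d z powr (p - 1) * box_vol d z = box_vol d z powr p"
        using powr_add[of "box_vol d z" "p - 1" 1] by simp
      then show "c z * box_vol d z = A powr (- 1 / q) * (box_vol d z powr p * indicator (missing_boxes d P) z)"
        by (simp add: c_def ac_simps)
    qed
    also have "\<dots> = A powr (- 1 / q) * A powr 1"
      using \<open>A \<ge> 0\<close> by (simp add: A_def)
    also have "\<dots> = A powr (1 / p)"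
    proof -
      have "- 1 / q + 1 = 1 / p" using exps by simp
      then show ?thesis unfolding powr_add[symmetric] by simp
    qed
    finally show ?thesis .
  qed
  ultimately show ?thesis
    unfolding wc_error_def using c
    by (intro SUP_upper2[of "T_op d c"]) (auto simp: F_space_def missing_norm_def A_def)
qed

section \<open>The curse of dimensionality\<close>

text \<open>
  A lower bound for both errors that depends on the points through their number only. The maximum
  with \<open>0\<close> keeps the power meaningful when the union bound is void.
\<close>

definition rule_bound :: "nat \<Rightarrow> real \<Rightarrow> nat \<Rightarrow> real" where
  "rule_bound d p N = (max 0 (1 - real N * (1 - (1/3) powr (p + 2)) ^ d)) powr (1 / p) * L_ext_initial p d"

lemma rule_bound_le_missing_norm:
  assumes p: "0 < p" and P: "finite P" "P \<subseteq> unit_cube d"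
  shows "rule_bound d p (card P) \<le> missing_norm d p P"
proof -
  let ?J = "(1 / ((p + 1) * (p + 2))) ^ d" and ?k = "1 - real (card P) * (1 - (1/3) powr (p + 2)) ^ d"
  have "max 0 ?k * ?J \<le> (\<integral>z. box_vol d z powr p * indicator (missing_boxes d P) z \<partial>leb_boxes d)"
    using integral_missing_boxes_ge[OF assms]
    by (auto simp: max_def intro!: Bochner_Integration.integral_nonneg)
  then have "(max 0 ?k * ?J) powr (1 / p) \<le> missing_norm d p P"
    unfolding missing_norm_def using p by (intro powr_mono2) auto
  then show ?thesis
    using p by (simp add: rule_bound_def L_ext_initial_eq powr_mult)
qed

text \<open>
  After cancelling the initial discrepancy, the hypothesis bounds \<open>1 - N \<rho> ^ d\<close> by \<open>\<epsilon> powr p\<close>, where \<open>\<rho>\<close> is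
  the one-dimensional loss factor. The power is at most \<open>\<epsilon>\<close> as \<open>p \<ge> 1\<close> and \<open>\<epsilon> < 1\<close>.
\<close>

lemma card_ge_of_rule_bound_le:
  assumes p: "1 \<le> p" and \<epsilon>: "0 \<le> \<epsilon>" "\<epsilon> < 1/2"
    and le: "rule_bound d p N \<le> \<epsilon> * L_ext_initial p d"
  shows "(1 / (1 - (1/3) powr (p + 2))) ^ d * (1 - 2 * \<epsilon>) \<le> real N"
proof -
  let ?\<rho> = "1 - (1/3 :: real) powr (p + 2)"
  define m where "m = max 0 (1 - real N * ?\<rho> ^ d)"
  have \<rho>: "?\<rho> > 0"
    using powr_less_mono2[of "p + 2" "1/3" "1 :: real"] p by simp
  have "L_ext_initial p d > 0" using p by (simp add: L_ext_initial_eq)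
  then have "m powr (1 / p) \<le> \<epsilon>"
    using le by (simp add: rule_bound_def m_def)
  then have "(m powr (1 / p)) powr p \<le> \<epsilon> powr p"
    using p by (intro powr_mono2) auto
  then have "m \<le> \<epsilon> powr p"
    using p by (simp add: powr_powr m_def)
  also have "\<epsilon> powr p \<le> \<epsilon> powr 1"
    using p \<epsilon> by (intro powr_mono') auto
  finally have "1 - \<epsilon> \<le> real N * ?\<rho> ^ d"
    using \<epsilon> by (simp add: m_def)
  then have "1 - 2 * \<epsilon> \<le> real N * ?\<rho> ^ d"
    using \<epsilon> by linarith
  then show ?thesis
    using \<rho> by (simp add: power_divide field_simps)
qed

lemma le_ereal_of_enat_Inf:
  assumes "\<And>n. n \<in> S \<Longrightarrow> x \<le> ereal_of_enat n"
  shows "x \<le> ereal_of_enat (Inf S)"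
proof (cases "S = {}")
  case False
  then have "Inf S \<in> S"
    unfolding Inf_enat_def by (auto intro: LeastI)
  then show ?thesis by (rule assms)
qed (simp add: Inf_enat_def)

lemma nonneg_rulesD:
  assumes "(P, w) \<in> nonneg_rules N d"
  shows "finite P" "P \<subseteq> unit_cube d" "card P = N"
  using assms unit_cube_ho_subset[of d] by (auto simp: nonneg_rules_def)

theorem theorem5:
  "\<exists>C :: real \<Rightarrow> real. \<forall>q p :: real. 1 < q \<longrightarrow> 1 / p + 1 / q = 1 \<longrightarrow>
     1 < C p \<and>
     (\<forall>d \<ge> 1. \<forall>\<epsilon> \<in> {0..<1/2}.
        ereal (C p ^ d * (1 - 2 * \<epsilon>)) \<le> ereal_of_enat (N_disc p \<epsilon> d)) \<and>
     (\<forall>d \<ge> 1. \<forall>\<epsilon> \<in> {0..<1/2}.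
        ereal (C p ^ d * (1 - 2 * \<epsilon>)) \<le> ereal_of_enat (N_int q \<epsilon> d))"
proof (intro exI[of _ "\<lambda>p. 1 / (1 - (1/3) powr (p + 2))"] allI impI conjI ballI)
  fix q p :: real
  assume q: "1 < q" and conj: "1 / p + 1 / q = 1"
  have "0 < 1 / q" "1 / q < 1"
    using q by auto
  then have "0 < 1 / p" "1 / p < 1"
    using conj by linarith+
  then have p: "1 < p"
    by (simp add: zero_less_divide_iff)
  show "1 < 1 / (1 - (1/3) powr (p + 2))"
    using powr_less_mono2[of "p + 2" "1/3" "1 :: real"] p by simp
  fix d :: nat and \<epsilon> :: real
  assume \<epsilon>: "\<epsilon> \<in> {0..<1/2}"
  show "ereal ((1 / (1 - (1/3) powr (p + 2))) ^ d * (1 - 2 * \<epsilon>)) \<le> ereal_of_enat (N_disc p \<epsilon> d)"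
    unfolding N_disc_def
  proof (rule le_ereal_of_enat_Inf, safe)
    fix N assume N: "min_disc_nonneg p N d \<le> ereal (\<epsilon> * L_ext_initial p d)"
    have "ereal (rule_bound d p N) \<le> min_disc_nonneg p N d"
      unfolding min_disc_nonneg_def
    proof (rule INF_greatest, safe)
      fix P w assume "(P, w) \<in> nonneg_rules N d"
      note P = nonneg_rulesD[OF this]
      show "ereal (rule_bound d p N) \<le> ereal (L_ext d p P w)"
        using rule_bound_le_missing_norm[of p P d] missing_norm_le_L_ext[of p P d w] P p by simp
    qed
    also note N
    finally show "ereal ((1 / (1 - (1/3) powr (p + 2))) ^ d * (1 - 2 * \<epsilon>)) \<le> ereal_of_enat (enat N)"
      using card_ge_of_rule_bound_le[of p \<epsilon> d N] p \<epsilon> by simp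
  qed
  show "ereal ((1 / (1 - (1/3) powr (p + 2))) ^ d * (1 - 2 * \<epsilon>)) \<le> ereal_of_enat (N_int q \<epsilon> d)"
    unfolding N_int_def
  proof (rule le_ereal_of_enat_Inf, safe)
    fix N assume N: "min_error_nonneg q N d \<le> ereal \<epsilon> * initial_error q d"
    have "ereal (rule_bound d p N) \<le> min_error_nonneg q N d"
      unfolding min_error_nonneg_def
    proof (rule INF_greatest, safe)
      fix P w assume "(P, w) \<in> nonneg_rules N d"
      note P = nonneg_rulesD[OF this]
      have "rule_bound d p N \<le> missing_norm d p P"
        using rule_bound_le_missing_norm[of p P d] P p by simp
      then show "ereal (rule_bound d p N) \<le> wc_error d q (lin_rule P w)"
        using missing_norm_le_wc_error[OF p q conj P(1,2)] by (meson ereal_less_eq(3) order_trans)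
    qed
    also note N
    also have "ereal \<epsilon> * initial_error q d \<le> ereal \<epsilon> * ereal (L_ext_initial p d)"
      using \<epsilon> by (intro ereal_mult_left_mono initial_error_le[OF p q conj]) auto
    finally show "ereal ((1 / (1 - (1/3) powr (p + 2))) ^ d * (1 - 2 * \<epsilon>)) \<le> ereal_of_enat (enat N)"
      using card_ge_of_rule_bound_le[of p \<epsilon> d N] p \<epsilon> by simp
  qed
qed

end
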